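(* Let $\mathfrak{V}$ be a vessel such that both $\sigma_1$ and $\sigma_2$ are invertible. Then the $VR$ conditions in the direction of $e_1$ are satisfied if and only if the $VR$ conditions in the direction of $e_2$ are satisfied, where: the $VR$ conditions in the direction of $e_1$ are, for all $j,k=2,\ldots,d$: $[\sigma_1^{-1}\sigma_j,\sigma_1^{-1}\sigma_k]=0$; $[\sigma_1^{-1}\gamma_{1j},\sigma_1^{-1}\gamma_{1k}]=0$; $[\sigma_1^{-1}\sigma_k,\sigma_1^{-1}\gamma_{1j}]=[\sigma_1^{-1}\sigma_j,\sigma_1^{-1}\gamma_{1k}]$; $\gamma_{jk}=\sigma_j\sigma_1^{-1}\gamma_{1k}-\sigma_k\sigma_1^{-1}\gamma_{1j}$; the $VR$ conditions in the direction of $e_2$ are, for all $j,k\in\{1,3,4,\ldots,d\}$: $[\sigma_2^{-1}\sigma_j,\sigma_2^{-1}\sigma_k]=0$; $[\sigma_2^{-1}\gamma_{2j},\sigma_2^{-1}\gamma_{2k}]=0$; $[\sigma_2^{-1}\sigma_k,\sigma_2^{-1}\gamma_{2j}]=[\sigma_2^{-1}\sigma_j,\sigma_2^{-1}\gamma_{2k}]$; $\gamma_{jk}=\sigma_j\sigma_2^{-1}\gamma_{2k}-\sigma_k\sigma_2^{-1}\gamma_{2j}$.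
   Context: A (Livsic commutative operator) vessel is a collection $\mathfrak{V}=(\mathcal{H},\mathcal{E},\Phi,\{A_j\},\{\sigma_j\},\{\gamma_{jk}\},\{\gamma_{*jk}\})$, where $\mathcal{H},\mathcal{E}$ are separable Hilbert spaces, $A_1,\ldots,A_d$ are commuting bounded (not necessarily selfadjoint) operators on $\mathcal{H}$, $\Phi:\mathcal{H}\to\mathcal{E}$ is bounded, and $\sigma_j,\gamma_{jk},\gamma_{*jk}$ ($j,k=1,\ldots,d$) are bounded selfadjoint operators on $\mathcal{E}$ such that for all $j,k$: $A_k-A_k^*=i\Phi^*\sigma_k\Phi$; $\gamma_{jk}=-\gamma_{kj}$, $\gamma_{*jk}=-\gamma_{*kj}$; $\sigma_j\Phi A_k^*-\sigma_k\Phi A_j^*=\gamma_{jk}\Phi$; $\sigma_j\Phi A_k-\sigma_k\Phi A_j=\gamma_{*jk}\Phi$; $\gamma_{*jk}-\gamma_{jk}=i(\sigma_j\Phi\Phi^*\sigma_k-\sigma_k\Phi\Phi^*\sigma_j)$. *)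

theory Defs
  imports "HOL-Analysis.Analysis"
begin

text \<open>Complex inner product spaces, with an inner product that is linear in the first argument.
  The real scalar multiplication and the norm of the superclass are tied to the complex structure
  by \<open>scaleR_scaleC\<close> and \<open>cinner_self\<close>; the latter also gives positive definiteness. The zero space
  is not excluded.\<close>

class complex_inner = real_normed_vector +
  fixes scaleC :: "complex \<Rightarrow> 'a \<Rightarrow> 'a" (infixr \<open>*\<^sub>C\<close> 75)
    and cinner :: "'a \<Rightarrow> 'a \<Rightarrow> complex"
  assumes scaleC_add_right: "a *\<^sub>C (x + y) = a *\<^sub>C x + a *\<^sub>C y"
    and scaleC_add_left: "(a + b) *\<^sub>C x = a *\<^sub>C x + b *\<^sub>C x"
    and scaleC_scaleC: "a *\<^sub>C b *\<^sub>C x = (a * b) *\<^sub>C x"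
    and scaleR_scaleC: "scaleR r x = complex_of_real r *\<^sub>C x"
    and cinner_commute: "cinner x y = cnj (cinner y x)"
    and cinner_add_left: "cinner (x + y) z = cinner x z + cinner y z"
    and cinner_scaleC_left: "cinner (a *\<^sub>C x) y = a * cinner x y"
    and cinner_self: "cinner x x = complex_of_real ((norm x)\<^sup>2)"

class chilbert_space = complex_inner + complete_space

instantiation complex :: chilbert_space
begin

definition "scaleC_complex (a :: complex) (x :: complex) = a * x"
definition "cinner_complex (x :: complex) (y :: complex) = x * cnj y"

instance
  by standard
    (simp_all add: scaleC_complex_def cinner_complex_def algebra_simps scaleR_conv_of_real
       complex_norm_square del: of_real_power)

end

definition bounded_clinear :: "('a::complex_inner \<Rightarrow> 'b::complex_inner) \<Rightarrow> bool" where
  "bounded_clinear f \<longleftrightarrow> bounded_linear f \<and> (\<forall>c x. f (c *\<^sub>C x) = c *\<^sub>C f x)"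

text \<open>Between Hilbert spaces the adjoint of a bounded operator exists by the Riesz representation
  theorem; its uniqueness is elementary.\<close>

definition cadjoint :: "('a::complex_inner \<Rightarrow> 'b::complex_inner) \<Rightarrow> 'b \<Rightarrow> 'a" where
  "cadjoint f = (THE g. \<forall>x y. cinner (f x) y = cinner x (g y))"

lemma cadjoint_eqI:
  fixes f :: "'a::complex_inner \<Rightarrow> 'b::complex_inner"
  assumes "\<And>x y. cinner (f x) y = cinner x (g y)"
  shows "cadjoint f = g"
  unfolding cadjoint_def
proof (rule the_equality)
  show "\<forall>x y. cinner (f x) y = cinner x (g y)"
    using assms by blast
next
  fix h assume h: "\<forall>x y. cinner (f x) y = cinner x (h y)"
  show "h = g"
  proof
    fix y
    have "cinner (h y) x = cinner (g y) x" for x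
      using assms h by (metis cinner_commute)
    moreover have "cinner (h y) x = cinner (h y - g y) x + cinner (g y) x" for x
      by (metis cinner_add_left diff_add_cancel)
    ultimately have "cinner (h y - g y) (h y - g y) = 0"
      by (metis add_cancel_left_left)
    then show "h y = g y"
      by (simp add: cinner_self)
  qed
qed

definition bounded_selfadjoint :: "('a::complex_inner \<Rightarrow> 'a) \<Rightarrow> bool" where
  "bounded_selfadjoint f \<longleftrightarrow> bounded_clinear f \<and> cadjoint f = f"

text \<open>Invertibility in the algebra of bounded operators. For such an \<open>f\<close> the inverse operator is
  \<open>inv f\<close>.\<close>

definition invertible_operator :: "('a::complex_inner \<Rightarrow> 'a) \<Rightarrow> bool" where
  "invertible_operator f \<longleftrightarrow> (\<exists>g. bounded_clinear g \<and> f \<circ> g = id \<and> g \<circ> f = id)"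

definition commutator :: "('a::ab_group_add \<Rightarrow> 'a) \<Rightarrow> ('a \<Rightarrow> 'a) \<Rightarrow> 'a \<Rightarrow> 'a" where
  "commutator S T = (S \<circ> T) - (T \<circ> S)"

text \<open>The families are indexed by \<open>{1..d}\<close>; their values at other indices are irrelevant.
  The parameter \<open>\<gamma>s\<close> is the family \<open>\<gamma>\<^sub>*\<close>. Differences and negatives of operators are pointwise.\<close>

locale vessel =
  fixes d :: nat
    and A :: "nat \<Rightarrow> 'h::chilbert_space \<Rightarrow> 'h"
    and \<Phi> :: "'h \<Rightarrow> 'e::chilbert_space"
    and \<sigma> :: "nat \<Rightarrow> 'e \<Rightarrow> 'e"
    and \<gamma> \<gamma>s :: "nat \<Rightarrow> nat \<Rightarrow> 'e \<Rightarrow> 'e"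
  assumes separable_H: "separable_space (euclidean :: 'h topology)"
    and separable_E: "separable_space (euclidean :: 'e topology)"
    and A_bounded: "j \<in> {1..d} \<Longrightarrow> bounded_clinear (A j)"
    and A_commute: "j \<in> {1..d} \<Longrightarrow> k \<in> {1..d} \<Longrightarrow> A j \<circ> A k = A k \<circ> A j"
    and \<Phi>_bounded: "bounded_clinear \<Phi>"
    and \<sigma>_selfadjoint: "j \<in> {1..d} \<Longrightarrow> bounded_selfadjoint (\<sigma> j)"
    and \<gamma>_selfadjoint: "j \<in> {1..d} \<Longrightarrow> k \<in> {1..d} \<Longrightarrow> bounded_selfadjoint (\<gamma> j k)"
    and \<gamma>s_selfadjoint: "j \<in> {1..d} \<Longrightarrow> k \<in> {1..d} \<Longrightarrow> bounded_selfadjoint (\<gamma>s j k)"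
    and colligation: "k \<in> {1..d} \<Longrightarrow>
      A k - cadjoint (A k) = (\<lambda>x. \<i> *\<^sub>C (cadjoint \<Phi> \<circ> \<sigma> k \<circ> \<Phi>) x)"
    and \<gamma>_antisym: "j \<in> {1..d} \<Longrightarrow> k \<in> {1..d} \<Longrightarrow> \<gamma> j k = - \<gamma> k j"
    and \<gamma>s_antisym: "j \<in> {1..d} \<Longrightarrow> k \<in> {1..d} \<Longrightarrow> \<gamma>s j k = - \<gamma>s k j"
    and input_condition: "j \<in> {1..d} \<Longrightarrow> k \<in> {1..d} \<Longrightarrow>
      (\<sigma> j \<circ> \<Phi> \<circ> cadjoint (A k)) - (\<sigma> k \<circ> \<Phi> \<circ> cadjoint (A j)) = \<gamma> j k \<circ> \<Phi>"
    and output_condition: "j \<in> {1..d} \<Longrightarrow> k \<in> {1..d} \<Longrightarrow>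
      (\<sigma> j \<circ> \<Phi> \<circ> A k) - (\<sigma> k \<circ> \<Phi> \<circ> A j) = \<gamma>s j k \<circ> \<Phi>"
    and linkage_condition: "j \<in> {1..d} \<Longrightarrow> k \<in> {1..d} \<Longrightarrow>
      \<gamma>s j k - \<gamma> j k =
        (\<lambda>u. \<i> *\<^sub>C ((\<sigma> j \<circ> \<Phi> \<circ> cadjoint \<Phi> \<circ> \<sigma> k) - (\<sigma> k \<circ> \<Phi> \<circ> cadjoint \<Phi> \<circ> \<sigma> j)) u)"

text \<open>The VR conditions in the direction of the unit vector \<open>e\<^sub>l\<close>, meaningful when \<open>\<sigma> l\<close> is
  invertible; \<open>j\<close> and \<open>k\<close> range over all indices other than \<open>l\<close>.\<close>

definition VR_conditions ::
    "nat \<Rightarrow> (nat \<Rightarrow> 'e::ab_group_add \<Rightarrow> 'e) \<Rightarrow> (nat \<Rightarrow> nat \<Rightarrow> 'e \<Rightarrow> 'e) \<Rightarrow> nat \<Rightarrow> bool" where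
  "VR_conditions d \<sigma> \<gamma> l \<longleftrightarrow>
    (\<forall>j\<in>{1..d} - {l}. \<forall>k\<in>{1..d} - {l}.
      commutator (inv (\<sigma> l) \<circ> \<sigma> j) (inv (\<sigma> l) \<circ> \<sigma> k) = (\<lambda>_. 0) \<and>
      commutator (inv (\<sigma> l) \<circ> \<gamma> l j) (inv (\<sigma> l) \<circ> \<gamma> l k) = (\<lambda>_. 0) \<and>
      commutator (inv (\<sigma> l) \<circ> \<sigma> k) (inv (\<sigma> l) \<circ> \<gamma> l j) =
        commutator (inv (\<sigma> l) \<circ> \<sigma> j) (inv (\<sigma> l) \<circ> \<gamma> l k) \<and>
      \<gamma> j k = (\<sigma> j \<circ> inv (\<sigma> l) \<circ> \<gamma> l k) - (\<sigma> k \<circ> inv (\<sigma> l) \<circ> \<gamma> l j))"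

end

theory Submission
  imports Defs
begin

text \<open>Only the additivity of the operators matters. Put \<open>S\<^sub>j = \<sigma>\<^sub>l\<^sup>-\<^sup>1 \<sigma>\<^sub>j\<close>, \<open>G\<^sub>j = \<sigma>\<^sub>l\<^sup>-\<^sup>1 \<gamma>\<^sub>l\<^sub>j\<close>,
  so that \<open>S\<^sub>l = 1\<close> and \<open>G\<^sub>l = 0\<close> and the VR conditions hold for all indices, \<open>l\<close> included: they say
  that the pencils \<open>z S\<^sub>j + G\<^sub>j\<close> commute and that they determine \<open>\<gamma>\<close>. In the direction \<open>m\<close> one
  has \<open>a\<^sub>j = \<sigma>\<^sub>m\<^sup>-\<^sup>1 \<sigma>\<^sub>j = S\<^sub>m\<^sup>-\<^sup>1 S\<^sub>j\<close> and \<open>\<sigma>\<^sub>m\<^sup>-\<^sup>1 \<gamma>\<^sub>m\<^sub>j = G\<^sub>j - a\<^sub>j G\<^sub>m\<close>. The \<open>a\<^sub>j\<close> commute,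
  and all conditions in the direction \<open>m\<close> reduce to the identity
  \<open>[a\<^sub>j, G\<^sub>k] - [a\<^sub>k, G\<^sub>j] = a\<^sub>j G\<^sub>m a\<^sub>k - a\<^sub>k G\<^sub>m a\<^sub>j\<close>, which is checked after
  multiplication by \<open>S\<^sub>m\<close> on the left.\<close>

lemma additive_inv:
  fixes f :: "'a::ab_group_add \<Rightarrow> 'b::ab_group_add"
  assumes "Modules.additive f" "bij f"
  shows "Modules.additive (inv f)"
proof
  fix x y
  have "f (inv f x + inv f y) = x + y"
    using assms by (simp add: additive.add bij_is_surj surj_f_inv_f)
  then show "inv f (x + y) = inv f x + inv f y"
    using assms by (metis bij_inv_eq_iff)
qed

lemma additive_comp:
  "Modules.additive f \<Longrightarrow> Modules.additive g \<Longrightarrow> Modules.additive (f \<circ> g)"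
  by (simp add: Modules.additive_def)

lemma commutator_eq_zero_iff: "commutator S T = (\<lambda>_. 0) \<longleftrightarrow> (\<forall>x. S (T x) = T (S x))"
  by (simp add: commutator_def fun_eq_iff)

lemma commutator_eq_iff:
  "commutator S T = commutator U V \<longleftrightarrow>
    (\<forall>x. S (T x) - T (S x) = U (V x) - V (U x))"
  by (simp add: commutator_def fun_eq_iff)

text \<open>An abelian group may have 2-torsion, where antisymmetry does not force
  \<open>\<gamma> l l\<close> to vanish; hence the separate assumption.\<close>

lemma VR_conditions_change_direction:
  fixes \<sigma> :: "nat \<Rightarrow> 'e::ab_group_add \<Rightarrow> 'e"
  assumes l: "l \<in> {1..d}" and m: "m \<in> {1..d}"
    and \<sigma>: "\<And>j. j \<in> {1..d} \<Longrightarrow> Modules.additive (\<sigma> j)"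
    and \<gamma>: "\<And>j k. j \<in> {1..d} \<Longrightarrow> k \<in> {1..d} \<Longrightarrow> Modules.additive (\<gamma> j k)"
    and bij_l: "bij (\<sigma> l)" and bij_m: "bij (\<sigma> m)"
    and \<gamma>_diag: "\<gamma> l l = (\<lambda>_. 0)"
    and \<gamma>_anti: "\<And>j. j \<in> {1..d} \<Longrightarrow> \<gamma> j l = - \<gamma> l j"
    and VR: "VR_conditions d \<sigma> \<gamma> l"
  shows "VR_conditions d \<sigma> \<gamma> m"
proof -
  define S where "S j = inv (\<sigma> l) \<circ> \<sigma> j" for j
  define G where "G j = inv (\<sigma> l) \<circ> \<gamma> l j" for j
  define a where "a j = inv (\<sigma> m) \<circ> \<sigma> j" for j
  define H where "H j = inv (\<sigma> m) \<circ> \<gamma> m j" for j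
  note inv_l = additive_inv [OF \<sigma> [OF l] bij_l]
  note inv_m = additive_inv [OF \<sigma> [OF m] bij_m]
  have S_add: "Modules.additive (S j)" and G_add: "Modules.additive (G j)"
    and a_add: "Modules.additive (a j)"
    if "j \<in> {1..d}" for j
    unfolding S_def G_def a_def using that l \<sigma> \<gamma> inv_l inv_m by (auto intro: additive_comp)
  have S_l: "S l x = x" for x
    using bij_l by (simp add: S_def bij_is_inj)
  have G_l: "G l x = 0" for x
    using additive.zero [OF inv_l] by (simp add: G_def \<gamma>_diag)
  have \<sigma>_G: "\<sigma> l (G j x) = \<gamma> l j x" for j x
    using bij_l by (simp add: G_def bij_is_surj surj_f_inv_f)

  note VR' = VR [unfolded VR_conditions_def commutator_eq_zero_iff commutator_eq_iff,
    folded S_def G_def]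
  \<comment> \<open>\<open>VR'\<close> covers only indices other than \<open>l\<close>; the other
    cases hold because \<open>S l\<close> is the identity and \<open>G l\<close> is zero.\<close>
  have S_comm: "S j (S k x) = S k (S j x)"
    if "j \<in> {1..d}" "k \<in> {1..d}" for j k x
    using VR' that by (cases "j = l \<or> k = l") (auto simp: S_l)
  have G_comm: "G j (G k x) = G k (G j x)"
    if "j \<in> {1..d}" "k \<in> {1..d}" for j k x
    using VR' that by (cases "j = l \<or> k = l") (auto simp: G_l additive.zero [OF G_add])
  have SG: "S k (G j x) - G j (S k x) = S j (G k x) - G k (S j x)"
    if "j \<in> {1..d}" "k \<in> {1..d}" for j k x
    using VR' that
    by (cases "j = l \<or> k = l") (auto simp: S_l G_l additive.zero [OF S_add])
  have \<gamma>_eq: "\<gamma> j k x = \<sigma> j (G k x) - \<sigma> k (G j x)"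
    if "j \<in> {1..d}" "k \<in> {1..d}" for j k x
  proof (cases "j = l \<or> k = l")
    case True
    then show ?thesis
      using that \<gamma>_anti by (auto simp: G_l \<sigma>_G additive.zero [OF \<sigma>])
  next
    case False
    then have "\<gamma> j k = (\<sigma> j \<circ> inv (\<sigma> l) \<circ> \<gamma> l k) - (\<sigma> k \<circ> inv (\<sigma> l) \<circ> \<gamma> l j)"
      using VR that unfolding VR_conditions_def by blast
    then show ?thesis
      by (simp add: G_def)
  qed

  have S_m_inj: "S m x = S m y \<longleftrightarrow> x = y" for x y
    unfolding S_def comp_apply
    by (metis bij_inv_eq_iff bij_l bij_m)
  have S_a: "S m (a j x) = S j x" for j x
    using bij_m by (simp add: S_def a_def bij_is_surj surj_f_inv_f)
  have a_comm: "a j (a k x) = a k (a j x)"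
    if "j \<in> {1..d}" "k \<in> {1..d}" for j k x
  proof -
    \<comment> \<open>By \<open>S_a\<close>, and moving \<open>S m\<close> past \<open>S j\<close>,
      the left side is \<open>S j (S k x)\<close>, which is symmetric in \<open>j\<close> and
      \<open>k\<close>.\<close>
    have "S m (S m (a j (a k x))) = S m (S m (a k (a j x)))"
      using that m by (metis S_a S_comm)
    then show ?thesis
      by (simp add: S_m_inj)
  qed
  have S_a_comm: "S j (a k x) = S k (a j x)"
    if "j \<in> {1..d}" "k \<in> {1..d}" for j k x
    using a_comm [OF that] by (metis S_a)
  have \<sigma>_a_comm: "\<sigma> j (a k x) = \<sigma> k (a j x)"
    if "j \<in> {1..d}" "k \<in> {1..d}" for j k x
    using S_a_comm [OF that] bij_l unfolding S_def comp_apply by (metis bij_inv_eq_iff)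
  \<comment> \<open>This is \<open>\<gamma>_eq\<close> for the pair \<open>m\<close>,
    \<open>j\<close>, followed by the inverse of \<open>\<sigma> m\<close>.\<close>
  have H_eq: "H j x = G j x - a j (G m x)" if "j \<in> {1..d}" for j x
    using that m bij_m
    by (simp add: H_def a_def \<gamma>_eq additive.diff [OF inv_m] bij_is_inj)

  have key: "a j (G k x) - G k (a j x) - (a k (G j x) - G j (a k x)) =
      a j (G m (a k x)) - a k (G m (a j x))"
    if j: "j \<in> {1..d}" and k: "k \<in> {1..d}" for j k x
  proof -
    \<comment> \<open>In the difference of \<open>1\<close> and \<open>2\<close> the terms starting
      with \<open>G m\<close> cancel by \<open>S_a_comm\<close>; \<open>SG\<close> for
      \<open>j\<close>, \<open>k\<close> then removes all terms free of \<open>G m\<close>.\<close>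
    have 1: "S m (G k (a j x)) = S k (G m (a j x)) - G m (S k (a j x)) + G k (S j x)"
      using SG [OF k m, of "a j x"] by (simp add: S_a algebra_simps)
    have 2: "S m (G j (a k x)) = S j (G m (a k x)) - G m (S j (a k x)) + G j (S k x)"
      using SG [OF j m, of "a k x"] by (simp add: S_a algebra_simps)
    have "S m (a j (G k x) - G k (a j x) - (a k (G j x) - G j (a k x))) =
        S m (a j (G m (a k x)) - a k (G m (a j x)))"
      using SG [OF j k, of x]
      by (simp add: additive.diff [OF S_add [OF m]] additive.add [OF S_add [OF m]] S_a 1 2
          S_a_comm [OF j k] algebra_simps)
    then show ?thesis
      by (simp add: S_m_inj)
  qed

  have "a j (a k x) = a k (a j x) \<and> H j (H k x) = H k (H j x) \<and>
      a k (H j x) - H j (a k x) = a j (H k x) - H k (a j x) \<and>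
      \<gamma> j k x = \<sigma> j (H k x) - \<sigma> k (H j x)"
    if j: "j \<in> {1..d}" and k: "k \<in> {1..d}" for j k x
  proof (intro conjI)
    note diffs = additive.diff [OF a_add [OF j]] additive.diff [OF a_add [OF k]]
      additive.diff [OF G_add [OF j]] additive.diff [OF G_add [OF k]]
      additive.diff [OF G_add [OF m]] additive.diff [OF \<sigma> [OF j]] additive.diff [OF \<sigma> [OF k]]
    show "a j (a k x) = a k (a j x)"
      using a_comm j k .
    \<comment> \<open>After expansion \<open>G_comm\<close> moves a bare \<open>G m\<close> to the
      right end; what remains is \<open>key\<close> at \<open>G m x\<close>.\<close>
    show "H j (H k x) = H k (H j x)"
      using key [OF j k, of "G m x"]
      by (simp add: H_eq [OF j] H_eq [OF k] diffs G_comm [OF j k] G_comm [OF m j] G_comm [OF m k] algebra_simps)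
    show "a k (H j x) - H j (a k x) = a j (H k x) - H k (a j x)"
      using key [OF j k, of x] by (simp add: H_eq [OF j] H_eq [OF k] diffs a_comm [OF j k] algebra_simps)
    \<comment> \<open>The correction terms \<open>\<sigma> j (a k (G m x))\<close> are symmetric in
      \<open>j\<close> and \<open>k\<close>, so they cancel.\<close>
    show "\<gamma> j k x = \<sigma> j (H k x) - \<sigma> k (H j x)"
      by (simp add: H_eq [OF j] H_eq [OF k] diffs \<gamma>_eq [OF j k] \<sigma>_a_comm [OF j k])
  qed
  then show ?thesis
    unfolding VR_conditions_def commutator_eq_zero_iff commutator_eq_iff
    by (auto simp: a_def H_def fun_eq_iff)
qed

lemma bounded_clinear_additive: "bounded_clinear f \<Longrightarrow> Modules.additive f"
  by (simp add: bounded_clinear_def Modules.additive_def bounded_linear.linear linear_add)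

lemma invertible_operator_bij: "invertible_operator f \<Longrightarrow> bij f"
  by (auto simp: invertible_operator_def intro: o_bij)

lemma (in vessel) \<gamma>_diag:
  assumes "j \<in> {1..d}"
  shows "\<gamma> j j = (\<lambda>_. 0)"
proof
  fix x
  have "\<gamma> j j x = - \<gamma> j j x"
    using \<gamma>_antisym [OF assms assms] by (metis uminus_apply)
  then have "2 *\<^sub>R \<gamma> j j x = 0"
    by (metis eq_neg_iff_add_eq_0 scaleR_2)
  then show "\<gamma> j j x = 0"
    by simp
qed

text \<open>Apart from the VR hypothesis, \<open>l\<close> and \<open>m\<close> enter symmetrically,
  so both implications of the equivalence are instances.\<close>

lemma (in vessel) VR_conditions_imp:
  assumes "l \<in> {1..d}" "m \<in> {1..d}"
    and "invertible_operator (\<sigma> l)" "invertible_operator (\<sigma> m)"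
    and "VR_conditions d \<sigma> \<gamma> l"
  shows "VR_conditions d \<sigma> \<gamma> m"
proof (rule VR_conditions_change_direction [OF assms(1,2)])
  show "Modules.additive (\<sigma> j)" if "j \<in> {1..d}" for j
    using \<sigma>_selfadjoint [OF that] by (simp add: bounded_selfadjoint_def bounded_clinear_additive)
  show "Modules.additive (\<gamma> j k)" if "j \<in> {1..d}" "k \<in> {1..d}" for j k
    using \<gamma>_selfadjoint [OF that] by (simp add: bounded_selfadjoint_def bounded_clinear_additive)
  show "\<gamma> j l = - \<gamma> l j" if "j \<in> {1..d}" for j
    using \<gamma>_antisym that assms(1) .
qed (use assms in \<open>auto simp: \<gamma>_diag invertible_operator_bij\<close>)

theorem proposition4p2:
  fixes d :: nat
    and A :: "nat \<Rightarrow> 'h::chilbert_space \<Rightarrow> 'h"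
    and \<Phi> :: "'h \<Rightarrow> 'e::chilbert_space"
    and \<sigma> :: "nat \<Rightarrow> 'e \<Rightarrow> 'e"
    and \<gamma> \<gamma>s :: "nat \<Rightarrow> nat \<Rightarrow> 'e \<Rightarrow> 'e"
  assumes "d \<ge> 2"
    and "vessel d A \<Phi> \<sigma> \<gamma> \<gamma>s"
    and "invertible_operator (\<sigma> 1)"
    and "invertible_operator (\<sigma> 2)"
  shows "VR_conditions d \<sigma> \<gamma> 1 \<longleftrightarrow> VR_conditions d \<sigma> \<gamma> 2"
proof -
  interpret vessel d A \<Phi> \<sigma> \<gamma> \<gamma>s
    by fact
  have "1 \<in> {1..d}" "2 \<in> {1..d}"
    using assms(1) by auto
  then show ?thesis
    using VR_conditions_imp assms(3,4) by blast
qed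

end
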